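(* Fix an integer $d\ge 1$ and a real number $0\le\alpha\le\pi$ with $\alpha\neq\pi/2$. Let $\epsilon=\epsilon(n)$ satisfy $\epsilon\ge C_d\left(\frac{\log n}{n}\right)^{1/d}$ and $\epsilon\to 0$ as $n\to\infty$. Then, asymptotically almost surely, there is an injective group homomorphism $$\mathbb{Z}\hookrightarrow H_d\big(\mathcal{N}(\mathbb{S}^d_\alpha(n,\epsilon))\big),$$ and in particular $\mathrm{conn}\big(\mathcal{N}(\mathbb{S}^d_\alpha(n,\epsilon))\big)\le d-1$.
   Context: $\mathbb{S}^d$ is the unit sphere in $\mathbb{R}^{d+1}$ with geodesic distance $\mathbf{d}$ and uniform probability measure. For $\alpha,\epsilon\ge 0$ and $X\subset\mathbb{S}^d$, $\mathbb{S}^d_\alpha(X,\epsilon)$ is the graph with vertex set $X$ and $x\sim y$ iff $x\ne y$ and $\alpha-\epsilon\le \mathbf{d}(x,y)\le\alpha+\epsilon$. The random $\epsilon$-distance graph $\mathbb{S}^d_\alpha(n,\epsilon)$ is $\mathbb{S}^d_\alpha(X,\epsilon)$ with $X=\{X_1,\dots,X_n\}$, where the $X_i$ are i.i.d. uniform on $\mathbb{S}^d$. An event (depending on $n$) holds asymptotically almost surely (a.a.s.) if its probability tends to $1$ as $n\to\infty$. A set $X\subset\mathbb{S}^d$ is a $\delta$-net if every point of $\mathbb{S}^d$ is at geodesic distance at most $\delta$ from some point of $X$. $C_d$ denotes a fixed constant, depending only on $d$, with the property that whenever $\epsilon(n)\ge C_d(\log n/n)^{1/d}$ and $\epsilon(n)\to0$,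 a.a.s. $n$ i.i.d. uniform points of $\mathbb{S}^d$ form an $(\epsilon/4)$-net of $\mathbb{S}^d$ (such a constant exists). For a graph $G$, the neighborhood complex $\mathcal{N}(G)$ is the simplicial complex with vertex set $V(G)$ whose simplices are all $A\subset V(G)$ such that $\bigcap_{v\in A}N(v)\ne\emptyset$, where $N(v)$ is the set of neighbors of $v$. $H_d$ is homology with integer coefficients. A nonempty space is $k$-connected ($k\ge0$) if for every $\ell=0,\dots,k$ every continuous map from $\mathbb{S}^\ell$ to it extends to the ball $\mathbb{B}^{\ell+1}$; $\mathrm{conn}(Y)$ is the largest $k$ such that $Y$ is $k$-connected (with $\mathrm{conn}(Y)=-1$ if $Y$ is nonempty but not $0$-connected). For a simplicial complex, these notions refer to its geometric realization. *)

theory Defs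
  imports "HOL-Probability.Probability" "HOL-Homology.Homology"
begin

section \<open>Random points on the sphere\<close>

definition geodesic_dist :: "real^'n \<Rightarrow> real^'n \<Rightarrow> real" where
  "geodesic_dist x y = arccos (x \<bullet> y)"

text \<open>
  The uniform probability measure on the unit sphere as the cone measure: the measure of \<open>A\<close> is
  the normalised Lebesgue measure of the points \<open>x\<close> of the unit ball with
  \<open>sgn x = x /\<^sub>R norm x \<in> A\<close>. The lemmas below show that it is a probability measure and is
  invariant under orthogonal transformations, which characterises it. (The invariance is stated
  for well-ordered index types only because the library's change of variables is.)
\<close>

definition uniform_sphere :: "(real^'n) measure" where
  "uniform_sphere =
     restrict_space (distr (uniform_measure lborel (ball 0 1)) borel sgn) (sphere 0 1)"

lemma sets_uniform_sphere: "sets (uniform_sphere :: (real^'n) measure) = sets (restrict_space borel (sphere 0 1))"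
  unfolding uniform_sphere_def by (simp add: sets_restrict_space)

lemma space_uniform_sphere: "space (uniform_sphere :: (real^'n) measure) = sphere 0 1"
  unfolding uniform_sphere_def by (simp add: space_restrict_space)

lemma prob_space_uniform_ball:
  "prob_space (uniform_measure lborel (ball 0 1 :: (real^'n) set))"
proof (rule prob_space_uniform_measure)
  show "emeasure lborel (ball 0 1 :: (real^'n) set) \<noteq> 0"
    using open_not_negligible[of "ball 0 1 :: (real^'n) set"] by (auto simp: negligible_iff_emeasure0)
  show "emeasure lborel (ball 0 1 :: (real^'n) set) \<noteq> \<infinity>"
    by (simp add: emeasure_ball)
qed

lemma measurable_sgn_vec: "sgn \<in> borel_measurable (borel :: (real^'n) measure)"
  by (simp add: sgn_div_norm[abs_def])

lemma prob_space_uniform_sphere: "prob_space (uniform_sphere :: (real^'n) measure)"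
proof
  let ?U = "uniform_measure lborel (ball 0 1 :: (real^'n) set)"
  interpret U: prob_space ?U
    by (rule prob_space_uniform_ball)
  have [measurable]: "sgn \<in> borel_measurable (borel :: (real^'n) measure)"
    by (rule measurable_sgn_vec)
  have "emeasure uniform_sphere (space (uniform_sphere :: (real^'n) measure))
      = emeasure ?U (sgn -` sphere 0 1)"
    unfolding space_uniform_sphere unfolding uniform_sphere_def
    by (simp add: emeasure_restrict_space emeasure_distr)
  also have "sgn -` sphere 0 1 = - {0 :: real^'n}"
    by (auto simp: norm_sgn)
  also have "emeasure ?U (- {0}) = emeasure ?U (space ?U)"
  proof (rule emeasure_eq_AE)
    have "AE x in lborel. x \<noteq> (0 :: real^'n)"
      by (rule AE_lborel_singleton)
    then show "AE x in ?U. (x \<in> - {0}) = (x \<in> space ?U)"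
      by (intro AE_uniform_measureI) auto
  qed auto
  finally show "emeasure uniform_sphere (space (uniform_sphere :: (real^'n) measure)) = 1"
    using U.emeasure_space_1 by simp
qed

lemma distr_lborel_orthogonal:
  fixes T :: "real^'n::{finite,wellorder} \<Rightarrow> real^'n::_"
  assumes "orthogonal_transformation T"
  shows "distr lborel borel T = lborel"
proof (rule lborel_eqI[symmetric])
  have meas [measurable]: "T \<in> borel_measurable borel"
    using assms by (intro borel_measurable_continuous_onI linear_continuous_on)
      (simp add: orthogonal_transformation_linear linear_linear)
  fix l u :: "real^'n::{finite,wellorder}"
  assume le: "\<And>b. b \<in> Basis \<Longrightarrow> l \<bullet> b \<le> u \<bullet> b"
  have inv: "T -` box l u = inv_into UNIV T ` box l u"
    using assms by (simp add: bij_vimage_eq_inv_image orthogonal_transformation_bij)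
  have "inv_into UNIV T ` box l u \<in> lmeasurable"
    using measurable_orthogonal_image[OF orthogonal_transformation_inv[OF assms]] by simp
  moreover have "inv_into UNIV T ` box l u \<in> sets borel"
    unfolding inv[symmetric] using measurable_sets[OF meas, of "box l u"] by simp
  ultimately have "emeasure lborel (inv_into UNIV T ` box l u) = ennreal (measure lebesgue (inv_into UNIV T ` box l u))"
    using emeasure_eq_measure2[of "inv_into UNIV T ` box l u" lebesgue]
    by (simp add: main_part_sets)
  also have "measure lebesgue (inv_into UNIV T ` box l u) = measure lebesgue (box l u)"
    using measure_orthogonal_image[OF orthogonal_transformation_inv[OF assms]] by simp
  finally show "emeasure (distr lborel borel T) (box l u) = (\<Prod>b\<in>Basis. (u - l) \<bullet> b)"
    using le by (simp add: emeasure_distr inv measure_completion)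
qed simp

lemma uniform_sphere_orthogonal_invariant:
  fixes T :: "real^'n::{finite,wellorder} \<Rightarrow> real^'n::_"
  assumes T: "orthogonal_transformation T"
  shows "distr uniform_sphere uniform_sphere T = uniform_sphere"
proof (rule measure_eqI)
  let ?B = "ball 0 1 :: (real^'n::{finite,wellorder}) set"
  let ?U = "uniform_measure lborel ?B"
  have measT [measurable]: "T \<in> borel_measurable borel"
    using assms by (intro borel_measurable_continuous_onI linear_continuous_on)
      (simp add: orthogonal_transformation_linear linear_linear)
  have sgn [measurable]: "sgn \<in> borel_measurable (borel :: (real^'n::{finite,wellorder}) measure)"
    by (rule measurable_sgn_vec)
  have normT: "norm (T x) = norm x" for x
    using T by (rule orthogonal_transformation_norm)
  have sgnT: "sgn (T x) = T (sgn x)" for x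
    using orthogonal_transformation_linear[OF T] by (simp add: sgn_div_norm normT linear_scale)
  have T': "T \<in> uniform_sphere \<rightarrow>\<^sub>M uniform_sphere"
    unfolding measurable_cong_sets[OF sets_uniform_sphere sets_uniform_sphere]
    by (rule measurable_restrict_space3) (auto simp: normT)
  show "sets (distr uniform_sphere uniform_sphere T) = sets uniform_sphere"
    by simp
  fix A
  assume "A \<in> sets (distr uniform_sphere uniform_sphere T)"
  then have A: "A \<in> sets uniform_sphere" and A': "A \<subseteq> sphere 0 1" and [measurable]: "A \<in> sets borel"
    by (auto simp: sets_uniform_sphere sets_restrict_space)
  have em: "emeasure uniform_sphere S = emeasure lborel (?B \<inter> sgn -` S) / emeasure lborel ?B"
    if "S \<subseteq> sphere 0 1" and [measurable]: "S \<in> sets borel" for S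
    using that(1) measurable_sets[OF sgn that(2)] unfolding uniform_sphere_def
    by (simp add: emeasure_restrict_space emeasure_distr)
  have TA: "T -` A \<inter> sphere 0 1 = T -` A"
    using A' by (auto simp: normT)
  have mTA: "T -` A \<in> sets borel"
    using measurable_sets[OF measT, of A] by simp
  have "emeasure (distr uniform_sphere uniform_sphere T) A = emeasure uniform_sphere (T -` A)"
    using T' A by (simp add: emeasure_distr space_uniform_sphere TA)
  also have "\<dots> = emeasure lborel (?B \<inter> sgn -` T -` A) / emeasure lborel ?B"
    using TA mTA by (intro em) auto
  also have "?B \<inter> sgn -` T -` A = T -` (?B \<inter> sgn -` A)"
    by (auto simp: normT sgnT)
  also have "emeasure lborel (T -` (?B \<inter> sgn -` A)) = emeasure (distr lborel borel T) (?B \<inter> sgn -` A)"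
    using measurable_sets[OF sgn, of A] by (subst emeasure_distr) auto
  also have "\<dots> = emeasure lborel (?B \<inter> sgn -` A)"
    by (simp add: distr_lborel_orthogonal[OF T])
  also have "\<dots> / emeasure lborel ?B = emeasure uniform_sphere A"
    using A' by (intro em[symmetric]) auto
  finally show "emeasure (distr uniform_sphere uniform_sphere T) A = emeasure uniform_sphere A" .
qed

definition uniform_points :: "nat \<Rightarrow> (nat \<Rightarrow> real^'n) measure" where
  "uniform_points n = Pi\<^sub>M {..<n} (\<lambda>_. uniform_sphere)"

text \<open>
  \<open>P n X\<close> is a property of the set \<open>X = {X\<^sub>1, \<dots>, X\<^sub>n}\<close> of \<open>n\<close> independent uniform points.
\<close>

definition asymptotically_almost_surely :: "(nat \<Rightarrow> (real^'n) set \<Rightarrow> bool) \<Rightarrow> bool" where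
  "asymptotically_almost_surely P \<longleftrightarrow>
     (\<lambda>n. measure (uniform_points n) {x \<in> space (uniform_points n). P n (x ` {..<n})})
       \<longlonglongrightarrow> 1"

definition geodesic_net :: "real \<Rightarrow> (real^'n) set \<Rightarrow> bool" where
  "geodesic_net \<delta> X \<longleftrightarrow>
     X \<subseteq> sphere 0 1 \<and> (\<forall>y\<in>sphere 0 1. \<exists>x\<in>X. geodesic_dist y x \<le> \<delta>)"

definition admissible_rate :: "nat \<Rightarrow> real \<Rightarrow> (nat \<Rightarrow> real) \<Rightarrow> bool" where
  "admissible_rate d C \<epsilon> \<longleftrightarrow>
     (\<forall>n\<ge>1. \<epsilon> n \<ge> C * (ln (real n) / real n) powr (1 / real d)) \<and> \<epsilon> \<longlonglongrightarrow> 0"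


section \<open>Graphs and neighborhood complexes\<close>

text \<open>A graph is a pair of a vertex set and a symmetric irreflexive adjacency relation on it.\<close>

type_synonym 'a graph = "'a set \<times> ('a \<times> 'a) set"

definition distance_graph :: "real \<Rightarrow> (real^'n) set \<Rightarrow> real \<Rightarrow> (real^'n) graph" where
  "distance_graph \<alpha> X \<epsilon> =
     (X, {(x, y). x \<in> X \<and> y \<in> X \<and> x \<noteq> y \<and>
            \<alpha> - \<epsilon> \<le> geodesic_dist x y \<and> geodesic_dist x y \<le> \<alpha> + \<epsilon>})"

definition neighbors :: "'a graph \<Rightarrow> 'a \<Rightarrow> 'a set" where
  "neighbors G v = {w. (v, w) \<in> snd G}"

definition neighborhood_complex :: "'a graph \<Rightarrow> 'a set set" where
  "neighborhood_complex G = {A. A \<subseteq> fst G \<and> fst G \<inter> (\<Inter>v\<in>A. neighbors G v) \<noteq> {}}"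

text \<open>
  Barycentric coordinates, as for \<^const>\<open>standard_simplex\<close>. For finite complexes (the only ones
  needed) the topology of pointwise convergence is the usual topology of the realization. The
  condition on the sum forces the support to be finite and nonempty, so it does not matter
  whether the empty set is counted as a simplex.
\<close>

definition geometric_realization :: "'a set set \<Rightarrow> ('a \<Rightarrow> real) topology" where
  "geometric_realization K =
     subtopology (powertop_real UNIV)
       {t. (\<forall>v. 0 \<le> t v) \<and> {v. t v \<noteq> 0} \<in> K \<and> (\<Sum>v | t v \<noteq> 0. t v) = 1}"


section \<open>Connectivity\<close>

definition nball :: "nat \<Rightarrow> (nat \<Rightarrow> real) topology" where
  "nball m = subtopology (Euclidean_space m) {x. (\<Sum>i<m. x i ^ 2) \<le> 1}"

definition k_connected_space :: "nat \<Rightarrow> 'a topology \<Rightarrow> bool" where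
  "k_connected_space k Y \<longleftrightarrow>
     topspace Y \<noteq> {} \<and>
     (\<forall>l\<le>k. \<forall>f. continuous_map (nsphere l) Y f \<longrightarrow>
        (\<exists>g. continuous_map (nball (Suc l)) Y g \<and> (\<forall>x\<in>topspace (nsphere l). g x = f x)))"

text \<open>
  The value is \<open>\<infinity>\<close> if \<open>Y\<close> is \<open>k\<close>-connected for all \<open>k\<close>. Otherwise the supremum is a maximum,
  since \<open>k\<close>-connectedness is antitone in \<open>k\<close>. The value on the empty space is the usual
  convention.
\<close>

definition conn :: "'a topology \<Rightarrow> ereal" where
  "conn Y =
     (if topspace Y = {} then -2
      else if \<not> k_connected_space 0 Y then -1
      else (SUP k\<in>{k. k_connected_space k Y}. ereal (real k)))"

end

(*
  If an \<epsilon>/4-net X of the sphere is given, a partition of unity sends the sphere to the neighborhood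
  complex N: the points of X near y have a common neighbor, namely a point of X near one at
  distance \<alpha> from y. Conversely a simplex of N lies in an annulus of radii \<alpha> - \<epsilon>, \<alpha> + \<epsilon> around a
  vertex w, hence in the open hemisphere around w or -w as \<alpha> is not \<pi>/2; so the linear extension
  of the inclusion of X avoids 0 and can be normalised to a map from N to the sphere. The composite
  moves each y by less than a right angle and is therefore homotopic to the identity. Thus H_d of
  the sphere embeds into H_d(N), and no extension of the first map to the ball exists.

  The probability of a non-measurable set is 0 in Isabelle, so the event has to be shown measurable:
  up to homeomorphism N depends only on the finitely many possible patterns of coincidence and
  adjacency of the n points.
*)
theory Submission
  imports Defs
begin

section \<open>Spaces dominating a sphere\<close>

text \<open>The conclusion of the theorem for a single space, made a predicate of the topology so
  that its invariance under homeomorphism can be stated.\<close>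

definition has_essential_sphere :: "nat \<Rightarrow> 'a topology \<Rightarrow> bool" where
  "has_essential_sphere d N \<longleftrightarrow>
     (\<exists>h \<in> hom integer_group (homology_group (int d) N). inj_on h (carrier integer_group)) \<and>
     conn N \<le> ereal (real d - 1)"

text \<open>Shrinking the sphere radially to the center of the ball gives the homotopy taking (s, x)
  to g(s x).\<close>

lemma nball_extension_imp_nullhomotopic:
  assumes g: "continuous_map (nball (Suc d)) Y g"
  shows "homotopic_with (\<lambda>_. True) (nsphere d) Y (\<lambda>x. g (\<lambda>i. 0)) g"
  unfolding homotopic_with_def
proof (intro exI conjI allI ballI)
  let ?h = "\<lambda>z :: real \<times> (nat \<Rightarrow> real). (\<lambda>i. fst z * snd z i)"
  show "continuous_map (prod_topology (top_of_set {0..1}) (nsphere d)) Y (g \<circ> ?h)"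
  proof (rule continuous_map_compose[OF _ g])
    have "continuous_map (prod_topology (top_of_set {0..1}) (nsphere d)) (powertop_real UNIV) ?h"
      unfolding continuous_map_componentwise_UNIV
    proof
      fix k
      have "continuous_map (nsphere d) euclideanreal (\<lambda>x. x k)"
        unfolding nsphere
        by (intro continuous_map_from_subtopology continuous_map_product_projection) auto
      then have "continuous_map (prod_topology (top_of_set {0..1::real}) (nsphere d)) euclideanreal (\<lambda>z. snd z k)"
        using continuous_map_compose[OF continuous_map_snd] by (fastforce simp: o_def)
      moreover have "continuous_map (prod_topology (top_of_set {0..1::real}) (nsphere d)) euclideanreal fst"
        using continuous_map_into_fulltopology[OF continuous_map_fst] by blast
      ultimately show "continuous_map (prod_topology (top_of_set {0..1}) (nsphere d)) euclideanreal (\<lambda>z. fst z * snd z k)"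
        by (intro continuous_map_real_mult)
    qed
    \<comment> \<open>The sphere \<open>nsphere d\<close> has coordinates 0 to d and bounds
      \<open>nball (Suc d)\<close>; a scaled point has sum of squares s^2, which is at most
      1.\<close>
    moreover have "?h z \<in> {x. (\<Sum>i<Suc d. (x i)\<^sup>2) \<le> 1} \<inter> {x. \<forall>i\<ge>Suc d. x i = 0}"
      if "z \<in> topspace (prod_topology (top_of_set {0..1}) (nsphere d))" for z
    proof -
      obtain s x where z: "z = (s, x)"
        by (cases z)
      then have s: "0 \<le> s" "s \<le> 1" and x: "(\<Sum>i\<le>d. (x i)\<^sup>2) = 1" "\<forall>i>d. x i = 0"
        using that by (auto simp: nsphere)
      have "(\<Sum>i\<le>d. (s * x i)\<^sup>2) = s\<^sup>2"
        using x(1) by (simp add: power_mult_distrib flip: sum_distrib_left)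
      then show ?thesis
        using z s x(2) by (auto simp: lessThan_Suc_atMost power_le_one)
    qed
    ultimately show "continuous_map (prod_topology (top_of_set {0..1}) (nsphere d)) (nball (Suc d)) ?h"
      unfolding nball_def Euclidean_space_def subtopology_subtopology
      by (intro continuous_map_into_subtopology) auto
  qed
qed auto

text \<open>An extension \<open>g\<close> makes \<open>p \<circ> g\<close> null-homotopic on the
  sphere, while it is also homotopic to \<open>id\<close>; the sphere would be contractible.\<close>

lemma no_nball_extension_if_dominates_nsphere:
  assumes g: "continuous_map (nball (Suc d)) N g" and p: "continuous_map N (nsphere d) p"
    and eq: "\<And>x. x \<in> topspace (nsphere d) \<Longrightarrow> g x = q x"
    and hom: "homotopic_with (\<lambda>_. True) (nsphere d) (nsphere d) (p \<circ> q) id"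
  shows False
proof -
  have "homotopic_with (\<lambda>_. True) (nsphere d) (nsphere d) (\<lambda>x. (p \<circ> g) (\<lambda>i. 0)) (p \<circ> g)"
    by (intro nball_extension_imp_nullhomotopic continuous_map_compose[OF g p])
  moreover have "homotopic_with (\<lambda>_. True) (nsphere d) (nsphere d) (p \<circ> g) (p \<circ> q)"
    using homotopic_with_imp_continuous_maps[OF calculation] eq by (intro homotopic_with_equal) auto
  ultimately have "homotopic_with (\<lambda>_. True) (nsphere d) (nsphere d) id (\<lambda>x. (p \<circ> g) (\<lambda>i. 0))"
    using hom homotopic_with_trans homotopic_with_symD by metis
  then show False
    using non_contractible_space_nsphere contractible_space_def by blast
qed

text \<open>The map induced by \<open>p\<close> on homology is a left inverse of the one induced by
  \<open>q\<close>, which is therefore injective on a copy of the integers. Connectivity is bounded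
  because \<open>q\<close> itself does not extend to the ball.\<close>

lemma has_essential_sphere_if_dominates_nsphere:
  assumes "d \<ge> 1"
    and q: "continuous_map (nsphere d) N q" and p: "continuous_map N (nsphere d) p"
    and hom: "homotopic_with (\<lambda>_. True) (nsphere d) (nsphere d) (p \<circ> q) id"
  shows "has_essential_sphere d N"
  unfolding has_essential_sphere_def
proof
  let ?H = "homology_group (int d) (nsphere d)"
  let ?q = "hom_induced (int d) (nsphere d) {} N {} q"
  let ?p = "hom_induced (int d) N {} (nsphere d) {} p"
  \<comment> \<open>For d >= 1 reduced and ordinary homology agree in degree d.\<close>
  have "?H \<cong> integer_group"
    using reduced_homology_group_nsphere(1)[of d] \<open>d \<ge> 1\<close> by (simp add: un_reduced_homology_group)
  then obtain h where h: "h \<in> iso integer_group ?H"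
    using group.iso_sym is_isoI unfolding is_iso_def by (metis ex_in_conv group_relative_homology_group)
  have inv: "?p (?q c) = c" if "c \<in> carrier ?H" for c
  proof -
    have "?p (?q c) = hom_induced (int d) (nsphere d) {} (nsphere d) {} (p \<circ> q) c"
      by (simp add: hom_induced_compose_empty[OF q p])
    also have "\<dots> = c"
      using that by (simp add: homology_homotopy_empty[OF hom] hom_induced_id)
    finally show ?thesis .
  qed
  have "?q \<circ> h \<in> hom integer_group (homology_group (int d) N)"
    using h hom_induced_empty_hom by (intro hom_compose) (auto simp: iso_def)
  moreover have "inj_on (?q \<circ> h) (carrier integer_group)"
    using h inv by (intro comp_inj_on inj_on_inverseI[where g = ?p]) (auto simp: iso_def bij_betw_def)
  ultimately show "\<exists>h\<in>hom integer_group (homology_group (int d) N). inj_on h (carrier integer_group)"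
    by blast
  have "\<not> k_connected_space k N" if "d \<le> k" for k
    using that q no_nball_extension_if_dominates_nsphere[OF _ p _ hom] unfolding k_connected_space_def by metis
  then have "ereal (real k) \<le> ereal (real d - 1)" if "k_connected_space k N" for k
    using that by (metis One_nat_def Suc_leI ereal_less_eq(3) le_diff_eq not_less of_nat_Suc of_nat_le_iff add.commute)
  \<comment> \<open>Besides the supremum over k < d, \<open>conn\<close> can take the values -2 and
    -1, which are below d - 1.\<close>
  then show "conn N \<le> ereal (real d - 1)"
    using \<open>d \<ge> 1\<close> unfolding conn_def
    by (auto intro!: SUP_least simp: numeral_eq_ereal one_ereal_def simp del: ereal_eq_1)
qed

text \<open>An orthogonal basis identifies the unit sphere with \<open>nsphere d\<close>, whose
  homology is known; the maps and the homotopy are transported along this homeomorphism.\<close>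

lemma has_essential_sphere_if_dominates_sphere:
  fixes f :: "'a::euclidean_space \<Rightarrow> 'b"
  assumes "DIM('a) = d + 1" and "d \<ge> 1"
    and f: "continuous_map (top_of_set (sphere 0 1)) N f" and p: "continuous_map N (top_of_set (sphere 0 1)) p"
    and hom: "homotopic_with (\<lambda>_. True) (top_of_set (sphere 0 1)) (top_of_set (sphere 0 1)) (p \<circ> f) id"
  shows "has_essential_sphere d N"
proof -
  have "pairwise orthogonal (Basis :: 'a set)"
    by (auto simp: pairwise_def orthogonal_def inner_Basis)
  then obtain u v where "homeomorphic_maps (nsphere d) (top_of_set (sphere (0::'a) 1 \<inter> span Basis)) u v"
    using homeomorphic_maps_nsphere_euclidean_sphere[of "Basis :: 'a set" "d + 1"] assms(1) independent_Basis
    by auto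
  then have u: "continuous_map (nsphere d) (top_of_set (sphere 0 1)) u"
    and v: "continuous_map (top_of_set (sphere 0 1)) (nsphere d) v"
    and vu: "\<And>x. x \<in> topspace (nsphere d) \<Longrightarrow> v (u x) = x"
    by (auto simp: homeomorphic_maps_def)
  have "homotopic_with (\<lambda>_. True) (nsphere d) (nsphere d) (v \<circ> ((p \<circ> f) \<circ> u)) (v \<circ> (id \<circ> u))"
    by (intro homotopic_with_compose_continuous_map_left[OF _ v]
        homotopic_with_compose_continuous_map_right[OF hom u]) auto
  moreover have "homotopic_with (\<lambda>_. True) (nsphere d) (nsphere d) (v \<circ> (id \<circ> u)) id"
    using vu homotopic_with_id2[of "nsphere d" v u] by (simp add: o_def)
  ultimately have "homotopic_with (\<lambda>_. True) (nsphere d) (nsphere d) ((v \<circ> p) \<circ> (f \<circ> u)) id"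
    using homotopic_with_trans by (metis comp_assoc)
  then show ?thesis
    by (rule has_essential_sphere_if_dominates_nsphere
        [OF assms(2) continuous_map_compose[OF u f] continuous_map_compose[OF p v]])
qed

section \<open>Invariance under homeomorphism\<close>

lemma k_connected_space_homeomorphic:
  assumes "homeomorphic_maps X Y f g" and "k_connected_space k Y"
  shows "k_connected_space k X"
  unfolding k_connected_space_def
proof (intro conjI allI impI)
  have f: "continuous_map X Y f" and g: "continuous_map Y X g"
    and gf: "\<And>x. x \<in> topspace X \<Longrightarrow> g (f x) = x"
    using assms(1) by (auto simp: homeomorphic_maps_def)
  show "topspace X \<noteq> {}"
    using assms(2) continuous_map_image_subset_topspace[OF g] unfolding k_connected_space_def by auto
  fix l s assume l: "l \<le> k" and s: "continuous_map (nsphere l) X s"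
  obtain e where e: "continuous_map (nball (Suc l)) Y e" "\<And>x. x \<in> topspace (nsphere l) \<Longrightarrow> e x = f (s x)"
    using assms(2) l continuous_map_compose[OF s f] unfolding k_connected_space_def o_def by metis
  have "(g \<circ> e) x = s x" if "x \<in> topspace (nsphere l)" for x
    using that e(2) gf continuous_map_funspace[OF s] by auto
  then show "\<exists>e. continuous_map (nball (Suc l)) X e \<and> (\<forall>x\<in>topspace (nsphere l). e x = s x)"
    using continuous_map_compose[OF e(1) g] by blast
qed

text \<open>Needed for measurability, where configurations of points with isomorphic graphs must be
  treated alike.\<close>

lemma has_essential_sphere_homeomorphic:
  assumes "X homeomorphic_space Y" and "has_essential_sphere d X"
  shows "has_essential_sphere d Y"
proof -
  obtain f g where fg: "homeomorphic_maps X Y f g"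
    using assms(1) by (auto simp: homeomorphic_space_def)
  have "k_connected_space k X \<longleftrightarrow> k_connected_space k Y" for k
    using k_connected_space_homeomorphic[OF fg] k_connected_space_homeomorphic[OF fg[THEN homeomorphic_maps_sym[THEN iffD1]]]
    by blast
  moreover have "topspace X = {} \<longleftrightarrow> topspace Y = {}"
    using homeomorphic_empty_space[OF assms(1)] by simp
  ultimately have "conn X = conn Y"
    unfolding conn_def by simp
  moreover obtain \<phi> where \<phi>: "\<phi> \<in> iso (homology_group (int d) X) (homology_group (int d) Y)"
    using homeomorphic_space_imp_isomorphic_homology_groups[OF assms(1), of "int d"]
    by (auto simp: is_iso_def)
  moreover obtain h where h: "h \<in> hom integer_group (homology_group (int d) X)"
      "inj_on h (carrier integer_group)"
    using assms(2) unfolding has_essential_sphere_def by blast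
  have "\<phi> \<circ> h \<in> hom integer_group (homology_group (int d) Y)"
    using h(1) \<phi> by (intro hom_compose) (auto simp: iso_def)
  moreover have "inj_on (\<phi> \<circ> h) (carrier integer_group)"
    using h \<phi> by (intro comp_inj_on) (auto simp: iso_def bij_betw_def hom_def intro: inj_on_subset)
  ultimately show ?thesis
    using assms(2) unfolding has_essential_sphere_def by metis
qed

section \<open>Realizations over a finite subset of the sphere\<close>

text \<open>The product topology is that of the function type, so continuity on a realization can be
  proved with \<open>continuous_on\<close>.\<close>

lemma geometric_realization_eq_top_of_set:
  "geometric_realization K =
     top_of_set {t. (\<forall>v. 0 \<le> t v) \<and> {v. t v \<noteq> 0} \<in> K \<and> (\<Sum>v | t v \<noteq> 0. t v) = 1}"
  by (simp add: geometric_realization_def euclidean_product_topology)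

text \<open>
  The support of the weights \<open>max 0 (x \<bullet> y - c')\<close> is an open cap, whereas a net controls
  closed caps only. As \<open>X\<close> is finite, an open cap that is slightly larger than a closed one
  meets \<open>X\<close> in the trace of a closed one.
\<close>
lemma open_cap_subset_closed_cap:
  fixes X :: "'a::euclidean_space set"
  assumes X: "finite X" and c: "0 < c"
  obtains c' where "0 < c'" "c' < c"
    "\<And>y. y \<in> sphere 0 1 \<Longrightarrow> \<exists>z\<in>sphere 0 1. \<forall>x\<in>X. c' < x \<bullet> y \<longrightarrow> c \<le> x \<bullet> z"
proof -
  \<comment> \<open>Positive thresholds tending to \<open>c\<close> from below; one of them will
    serve as \<open>c'\<close>.\<close>
  define b where "b n = c * (1 - inverse (real (Suc (Suc n))))" for n
  have "inverse (real (Suc (Suc n))) < 1" for n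
    using inverse_less_1_iff[of "real (Suc (Suc n))"] by linarith
  then have b: "0 < b n" "b n < c" for n
    using c by (auto simp: b_def intro!: mult_pos_pos)
  have "b \<longlonglongrightarrow> c * (1 - 0)"
    unfolding b_def using LIMSEQ_inverse_real_of_nat LIMSEQ_Suc by (intro tendsto_intros) blast
  then have b_lim: "b \<longlonglongrightarrow> c"
    by simp
  have "\<exists>n. \<forall>y\<in>sphere 0 1. \<exists>z\<in>sphere 0 1. \<forall>x\<in>X. b n < x \<bullet> y \<longrightarrow> c \<le> x \<bullet> z"
  proof (rule ccontr)
    assume "\<not> ?thesis"
    then have "\<forall>n. \<exists>y. y \<in> sphere 0 1 \<and> (\<forall>z\<in>sphere 0 1. \<exists>x\<in>X. b n < x \<bullet> y \<and> x \<bullet> z < c)"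
      by (force simp: not_le)
    from choice[OF this] obtain y where y: "\<And>n. y n \<in> sphere 0 1"
      and bad: "\<And>n z. z \<in> sphere 0 1 \<Longrightarrow> \<exists>x\<in>X. b n < x \<bullet> y n \<and> x \<bullet> z < c"
      by blast
    \<comment> \<open>The limit \<open>z\<close> of the bad centers is tested as the center of the
      closed cap.\<close>
    obtain z r where z: "z \<in> sphere 0 1" and r: "strict_mono r" and lim: "(y \<circ> r) \<longlonglongrightarrow> z"
      using compact_sphere y unfolding compact_def by (metis (no_types, lifting))
    have "\<forall>\<^sub>F n in sequentially. x \<bullet> y (r n) < b (r n)" if "x \<bullet> z < c" for x
    proof -
      have "(\<lambda>n. b (r n) - x \<bullet> y (r n)) \<longlonglongrightarrow> c - x \<bullet> z"
        using LIMSEQ_subseq_LIMSEQ[OF b_lim r] lim unfolding o_def by (intro tendsto_intros)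
      then have "\<forall>\<^sub>F n in sequentially. 0 < b (r n) - x \<bullet> y (r n)"
        using that by (intro order_tendstoD(1)) auto
      then show ?thesis
        by eventually_elim simp
    qed
    then have "\<forall>\<^sub>F n in sequentially. \<forall>x\<in>{x \<in> X. x \<bullet> z < c}. x \<bullet> y (r n) < b (r n)"
      using X by (intro eventually_ball_finite) auto
    then obtain n where "\<forall>x\<in>{x \<in> X. x \<bullet> z < c}. x \<bullet> y (r n) < b (r n)"
      using eventually_happens'[OF sequentially_bot] by fast
    \<comment> \<open>The point supplied by \<open>bad\<close> for \<open>z\<close> lies outside the
      closed cap around \<open>z\<close>, but by finiteness of \<open>X\<close> all such points lie
      outside the open cap around \<open>y (r n)\<close>.\<close>
    then show False
      using bad[OF z, of "r n"] by fastforce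
  qed
  then show ?thesis
    using b that by metis
qed

text \<open>
  The hypothesis \<open>half\<close> keeps the linear extension of \<open>X \<subseteq> sphere 0 1\<close> to the realization away
  from \<open>0\<close>.
\<close>
lemma has_essential_sphere_geometric_realization:
  fixes X :: "'a::euclidean_space set"
  assumes dim: "DIM('a) = d + 1" and d: "d \<ge> 1" and X: "finite X" and c: "0 < c"
    and cover: "\<And>y. y \<in> sphere 0 1 \<Longrightarrow> \<exists>x\<in>X. c \<le> x \<bullet> y"
    and cap: "\<And>y. y \<in> sphere 0 1 \<Longrightarrow> {x \<in> X. c \<le> x \<bullet> y} \<in> K"
    and down: "\<And>A B. A \<in> K \<Longrightarrow> B \<subseteq> A \<Longrightarrow> B \<in> K"
    and half: "\<And>A. A \<in> K \<Longrightarrow> A \<subseteq> X \<and> (\<exists>w. \<forall>v\<in>A. 0 < v \<bullet> w)"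
  shows "has_essential_sphere d (geometric_realization K)"
proof -
  let ?S = "sphere 0 1 :: 'a set"
  let ?T = "{t. (\<forall>v. 0 \<le> t v) \<and> {v. t v \<noteq> 0} \<in> K \<and> (\<Sum>v | t v \<noteq> 0. t v) = 1}"
  obtain c' where c': "0 < c'" "c' < c"
    and enlarge: "\<And>y. y \<in> ?S \<Longrightarrow> \<exists>z\<in>?S. \<forall>x\<in>X. c' < x \<bullet> y \<longrightarrow> c \<le> x \<bullet> z"
    using open_cap_subset_closed_cap[OF X c] by blast
  \<comment> \<open>\<open>L\<close> is the linear extension of the inclusion of \<open>X\<close>;
    \<open>f y\<close> will be the normalised weights on the open cap around
    \<open>y\<close>.\<close>
  define L :: "('a \<Rightarrow> real) \<Rightarrow> 'a" where "L t = (\<Sum>v\<in>X. t v *\<^sub>R v)" for t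
  define w :: "'a \<Rightarrow> 'a \<Rightarrow> real" where "w y v = max 0 (v \<bullet> y - c')" for y v
  define f where "f y v = (if v \<in> X then w y v / sum (w y) X else 0)" for y v

  have L_cont: "continuous_on U L" for U
    unfolding L_def
    by (intro continuous_intros continuous_on_subset[OF continuous_on_product_coordinates]) auto
  have L_nz: "L t \<noteq> 0" if t: "t \<in> ?T" for t
  proof -
    obtain u where u: "\<And>v. t v \<noteq> 0 \<Longrightarrow> 0 < v \<bullet> u" and sub: "{v. t v \<noteq> 0} \<subseteq> X"
      using t half[of "{v. t v \<noteq> 0}"] by auto
    obtain v where v: "t v \<noteq> 0"
      using t sum.neutral[of "{v. t v \<noteq> 0}" t] by force
    \<comment> \<open>All vertices in the support lie in one open half-space, so pairing
      \<open>L t\<close> with its normal \<open>u\<close> gives a positive number.\<close>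
    have "0 < (\<Sum>v\<in>X. t v * (v \<bullet> u))"
    proof (rule sum_pos2[OF X, of v])
      show "v \<in> X" "0 < t v * (v \<bullet> u)"
        using v u[OF v] sub t by (auto simp: less_le)
      show "0 \<le> t i * (i \<bullet> u)" for i
        using u[of i] t by (cases "t i = 0") (auto simp: less_imp_le)
    qed
    also have "\<dots> = L t \<bullet> u"
      by (simp add: L_def inner_sum_left)
    finally show ?thesis
      by auto
  qed
  have p: "continuous_map (geometric_realization K) (top_of_set ?S) (sgn \<circ> L)"
    unfolding geometric_realization_eq_top_of_set continuous_map_subtopology_eu o_def
    using L_nz by (auto simp: norm_sgn intro!: continuous_intros L_cont)

  have w_nonneg: "0 \<le> w y v" for y v
    by (simp add: w_def)
  have w_pos: "0 < sum (w y) X" if "y \<in> ?S" for y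
  proof -
    obtain x where "x \<in> X" "c \<le> x \<bullet> y"
      using cover \<open>y \<in> ?S\<close> by blast
    then show ?thesis
      using c' w_nonneg by (intro sum_pos2[OF X, of x]) (auto simp: w_def)
  qed
  have w_nz: "w y v \<noteq> 0 \<longleftrightarrow> c' < v \<bullet> y" for y v
    by (auto simp: w_def)
  have f_nz: "f y v \<noteq> 0 \<longleftrightarrow> v \<in> X \<and> c' < v \<bullet> y" if "y \<in> ?S" for y v
    using w_pos[OF that] w_nz[of y v] by (auto simp: f_def)
  have f_T: "f y \<in> ?T" if y: "y \<in> ?S" for y
  proof -
    obtain z where z: "z \<in> ?S" "\<forall>x\<in>X. c' < x \<bullet> y \<longrightarrow> c \<le> x \<bullet> z"
      using enlarge[OF y] by blast
    \<comment> \<open>The support is the trace of an open cap around \<open>y\<close>, contained in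
      that of a closed cap around another center \<open>z\<close>.\<close>
    have "{v. f y v \<noteq> 0} \<in> K"
      unfolding f_nz[OF y] using z(2) by (intro down[OF cap[OF z(1)]]) auto
    moreover have "(\<Sum>v | f y v \<noteq> 0. f y v) = sum (f y) X"
      using X f_nz[OF y] by (intro sum.mono_neutral_left) auto
    moreover have "sum (f y) X = (\<Sum>v\<in>X. w y v / sum (w y) X)"
      by (simp add: f_def)
    moreover have "\<dots> = 1"
      using w_pos[OF y] by (simp flip: sum_divide_distrib)
    moreover have "0 \<le> f y v" for v
      using w_pos[OF y] w_nonneg[of y v] by (auto simp: f_def intro!: divide_nonneg_pos)
    ultimately show ?thesis
      by simp
  qed
  have f_cont: "continuous_on ?S f"
  proof (rule continuous_on_coordinatewise_then_product)
    fix v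
    have "continuous_on ?S (\<lambda>y. w y v / sum (w y) X)"
      unfolding w_def using w_pos unfolding w_def by (intro continuous_intros) fastforce
    then show "continuous_on ?S (\<lambda>y. f y v)"
      by (cases "v \<in> X") (simp_all add: f_def)
  qed
  have f: "continuous_map (top_of_set ?S) (geometric_realization K) f"
    unfolding geometric_realization_eq_top_of_set continuous_map_subtopology_eu using f_cont f_T by blast

  have Lf: "0 < L (f y) \<bullet> y" if y: "y \<in> ?S" for y
  proof -
    obtain x where x: "x \<in> X" "c \<le> x \<bullet> y"
      using cover y by blast
    have pos: "0 < v \<bullet> y" if "f y v \<noteq> 0" for v
      using that f_nz[OF y] c' by fastforce
    have "f y x \<noteq> 0"
      using f_nz[OF y] x c' by auto
    have "0 < (\<Sum>v\<in>X. f y v * (v \<bullet> y))"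
    proof (rule sum_pos2[OF X x(1)])
      show "0 < f y x * (x \<bullet> y)"
        using pos[OF \<open>f y x \<noteq> 0\<close>] \<open>f y x \<noteq> 0\<close> f_T[OF y] by (auto simp: less_le)
      show "0 \<le> f y v * (v \<bullet> y)" for v
        using pos[of v] f_T[OF y] by (cases "f y v = 0") (auto simp: less_imp_le)
    qed
    then show ?thesis
      by (simp add: L_def inner_sum_left)
  qed
  \<comment> \<open>Both \<open>L (f y)\<close> and \<open>y\<close> have positive inner product
    with \<open>y\<close>, so the segment between them avoids 0. Normalising this straight-line
    homotopy gives one on the sphere.\<close>
  have "homotopic_with_canon (\<lambda>_. True) ?S (- {0}) (L \<circ> f) id"
  proof (rule homotopic_with_linear)
    show "continuous_on ?S (L \<circ> f)"
      by (intro continuous_on_compose f_cont L_cont)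
    show "closed_segment ((L \<circ> f) y) (id y) \<subseteq> - {0}" if y: "y \<in> ?S" for y
    proof
      fix x assume "x \<in> closed_segment ((L \<circ> f) y) (id y)"
      then obtain s where s: "0 \<le> s" "s \<le> 1" "x = (1 - s) *\<^sub>R L (f y) + s *\<^sub>R y"
        by (auto simp: closed_segment_def)
      have "y \<bullet> y = 1"
        using y by (simp add: norm_eq_1)
      then have "x \<bullet> y = (1 - s) * (L (f y) \<bullet> y) + s"
        by (simp add: s(3) inner_add_left)
      \<comment> \<open>For s < 1 the first summand is positive; at s = 1 it vanishes and the second
        is 1.\<close>
      also have "\<dots> > 0"
        using s(1,2) Lf[OF y] by (cases "s = 1") (auto intro: add_pos_nonneg)
      finally show "x \<in> - {0}"
        by auto
    qed
  qed (rule continuous_on_id')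
  then have "homotopic_with_canon (\<lambda>_. True) ?S ?S (sgn \<circ> (L \<circ> f)) (sgn \<circ> id)"
    by (rule homotopic_with_compose_continuous_map_left)
      (auto simp: continuous_map_subtopology_eu norm_sgn intro!: continuous_intros)
  moreover have "homotopic_with_canon (\<lambda>_. True) ?S ?S (sgn \<circ> id) id"
    using homotopic_with_imp_continuous_maps[OF calculation]
    by (intro homotopic_with_equal) (auto simp: sgn_div_norm)
  ultimately have "homotopic_with_canon (\<lambda>_. True) ?S ?S ((sgn \<circ> L) \<circ> f) id"
    using homotopic_with_trans by (metis comp_assoc)
  then show ?thesis
    by (rule has_essential_sphere_if_dominates_sphere[OF dim d f p])
qed

section \<open>Isomorphic graphs\<close>

text \<open>Weights are pulled back along the bijection. Barycentric coordinates are total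
  functions, hence the value 0 off \<open>W\<close>.\<close>

lemma continuous_map_geometric_realization_relabel:
  assumes bij: "bij_betw \<psi> W V"
    and sub: "\<And>A. A \<in> K \<Longrightarrow> A \<subseteq> V"
    and K: "\<And>A. A \<in> K \<Longrightarrow> {v \<in> W. \<psi> v \<in> A} \<in> K'"
  shows "continuous_map (geometric_realization K) (geometric_realization K')
           (\<lambda>t v. if v \<in> W then t (\<psi> v) else 0)"
  unfolding geometric_realization_eq_top_of_set continuous_map_subtopology_eu
proof
  let ?T = "{t. (\<forall>v. 0 \<le> t v) \<and> {v. t v \<noteq> 0} \<in> K \<and> (\<Sum>v | t v \<noteq> 0. t v) = (1::real)}"
  show "continuous_on ?T (\<lambda>t v. if v \<in> W then t (\<psi> v) else 0)"
  proof (rule continuous_on_coordinatewise_then_product)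
    show "continuous_on ?T (\<lambda>t. if v \<in> W then t (\<psi> v) else 0)" for v
      by (cases "v \<in> W") (auto intro: continuous_on_subset[OF continuous_on_product_coordinates])
  qed
  have "(\<Sum>v | (if v \<in> W then t (\<psi> v) else 0) \<noteq> 0. if v \<in> W then t (\<psi> v) else 0) = (\<Sum>v | t v \<noteq> 0. t v)"
    and "{v. (if v \<in> W then t (\<psi> v) else 0) \<noteq> 0} = {v \<in> W. \<psi> v \<in> {v. t v \<noteq> 0}}"
    if "{v. t v \<noteq> 0} \<subseteq> V" for t :: "_ \<Rightarrow> real"
  proof -
    show *: "{v. (if v \<in> W then t (\<psi> v) else 0) \<noteq> 0} = {v \<in> W. \<psi> v \<in> {v. t v \<noteq> 0}}"
      by auto
    have "bij_betw \<psi> {v \<in> W. \<psi> v \<in> {v. t v \<noteq> 0}} {v. t v \<noteq> 0}"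
      using bij that unfolding bij_betw_def inj_on_def by auto
    from sum.reindex_bij_betw[OF this, of t]
    show "(\<Sum>v | (if v \<in> W then t (\<psi> v) else 0) \<noteq> 0. if v \<in> W then t (\<psi> v) else 0) = (\<Sum>v | t v \<noteq> 0. t v)"
      unfolding * by (simp cong: sum.cong_simp)
  qed
  moreover have "{v \<in> W. \<psi> v \<in> {v. t v \<noteq> 0}} \<in> K'" "{v. t v \<noteq> 0} \<subseteq> V" if "t \<in> ?T" for t
    using that sub K[of "{v. t v \<noteq> 0}"] by blast+
  ultimately show "(\<lambda>t v. if v \<in> W then t (\<psi> v) else 0) \<in> ?T \<rightarrow>
      {t. (\<forall>v. 0 \<le> t v) \<and> {v. t v \<noteq> 0} \<in> K' \<and> (\<Sum>v | t v \<noteq> 0. t v) = 1}"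
    by (intro funcsetI CollectI conjI) simp_all
qed

lemma neighborhood_complex_relabel:
  assumes bij: "bij_betw \<psi> W V"
    and adj: "\<And>u v. u \<in> W \<Longrightarrow> v \<in> W \<Longrightarrow> (u, v) \<in> F \<longleftrightarrow> (\<psi> u, \<psi> v) \<in> E"
    and A: "A \<in> neighborhood_complex (V, E)"
  shows "{v \<in> W. \<psi> v \<in> A} \<in> neighborhood_complex (W, F)"
proof -
  obtain z where "z \<in> V" and z: "\<And>v. v \<in> A \<Longrightarrow> (v, z) \<in> E"
    using A by (auto simp: neighborhood_complex_def neighbors_def)
  then obtain z' where "z' \<in> W" "\<psi> z' = z"
    using bij by (auto simp: bij_betw_def)
  then show ?thesis
    using z adj by (auto simp: neighborhood_complex_def neighbors_def)
qed

text \<open>Relabeling along \<psi> and along its inverse are mutually inverse, because points of a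
  realization vanish off the vertex set.\<close>

lemma geometric_realization_neighborhood_complex_homeomorphic:
  assumes bij: "bij_betw \<psi> W V"
    and adj: "\<And>u v. u \<in> W \<Longrightarrow> v \<in> W \<Longrightarrow> (u, v) \<in> F \<longleftrightarrow> (\<psi> u, \<psi> v) \<in> E"
  shows "geometric_realization (neighborhood_complex (V, E)) homeomorphic_space
         geometric_realization (neighborhood_complex (W, F))"
proof -
  let ?K = "neighborhood_complex (V, E)" and ?L = "neighborhood_complex (W, F)"
  let ?\<phi> = "inv_into W \<psi>"
  let ?f = "\<lambda>t v. if v \<in> W then t (\<psi> v) else 0 :: real"
  let ?g = "\<lambda>t v. if v \<in> V then t (?\<phi> v) else 0 :: real"
  have bij': "bij_betw ?\<phi> V W"
    by (rule bij_betw_inv_into[OF bij])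
  have \<phi>: "?\<phi> v \<in> W" "\<psi> (?\<phi> v) = v" if "v \<in> V" for v
    using that bij bij' by (auto simp: bij_betw_def f_inv_into_f)
  have \<psi>: "\<psi> v \<in> V" "?\<phi> (\<psi> v) = v" if "v \<in> W" for v
    using that bij by (auto simp: bij_betw_def)
  have adj': "(u, v) \<in> E \<longleftrightarrow> (?\<phi> u, ?\<phi> v) \<in> F" if "u \<in> V" "v \<in> V" for u v
    using that adj \<phi> by simp
  have sub: "A \<subseteq> U" if "A \<in> neighborhood_complex (U, G)" for A U and G :: "('x \<times> 'x) set"
    using that by (simp add: neighborhood_complex_def)
  have "continuous_map (geometric_realization ?K) (geometric_realization ?L) ?f"
    by (rule continuous_map_geometric_realization_relabel[OF bij sub neighborhood_complex_relabel[OF bij adj]])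
  moreover have "continuous_map (geometric_realization ?L) (geometric_realization ?K) ?g"
    by (rule continuous_map_geometric_realization_relabel[OF bij' sub neighborhood_complex_relabel[OF bij' adj']])
  moreover have "?g (?f t) = t" if "t \<in> topspace (geometric_realization ?K)" for t
    using that sub[of "{v. t v \<noteq> 0}" V E] \<phi> by (fastforce simp: geometric_realization_eq_top_of_set)
  moreover have "?f (?g t) = t" if "t \<in> topspace (geometric_realization ?L)" for t
    using that sub[of "{v. t v \<noteq> 0}" W F] \<psi> by (fastforce simp: geometric_realization_eq_top_of_set)
  ultimately show ?thesis
    unfolding homeomorphic_space_def homeomorphic_maps_def by blast
qed

section \<open>Geodesic distance and caps of a net\<close>

lemma inner_unit_bounds:
  fixes x y :: "'a::real_inner"
  assumes "norm x = 1" "norm y = 1"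
  shows "- 1 \<le> x \<bullet> y" "x \<bullet> y \<le> 1"
  using Cauchy_Schwarz_ineq2[of x y] assms by auto

lemma geodesic_dist_bounds:
  assumes "norm x = 1" "norm y = 1"
  shows "0 \<le> geodesic_dist x y" "geodesic_dist x y \<le> pi" "cos (geodesic_dist x y) = x \<bullet> y"
  using inner_unit_bounds[OF assms] by (auto simp: geodesic_dist_def arccos_lbound arccos_ubound)

lemma geodesic_dist_commute: "geodesic_dist x y = geodesic_dist y x"
  by (simp add: geodesic_dist_def inner_commute)

lemma geodesic_dist_self: "norm x = 1 \<Longrightarrow> geodesic_dist x x = 0"
  by (simp add: geodesic_dist_def norm_eq_1)

lemma geodesic_dist_le_iff:
  assumes "norm x = 1" "norm y = 1" "0 \<le> r" "r \<le> pi"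
  shows "geodesic_dist x y \<le> r \<longleftrightarrow> cos r \<le> x \<bullet> y"
  using cos_mono_le_eq[of r "geodesic_dist x y"] geodesic_dist_bounds[OF assms(1,2)] assms(3,4) by simp

text \<open>The components of x and z orthogonal to y have the sines of the distances as norms.
  Cauchy-Schwarz then bounds the cosine of the sum of the distances by the inner product of x and z.
  If the sum exceeds pi, the claim is trivial.\<close>

lemma geodesic_dist_triangle:
  assumes x: "norm x = 1" and y: "norm y = 1" and z: "norm z = 1"
  shows "geodesic_dist x z \<le> geodesic_dist x y + geodesic_dist y z"
proof (cases "geodesic_dist x y + geodesic_dist y z \<le> pi")
  case True
  have sq: "norm (u - (u \<bullet> y) *\<^sub>R y) = sin (geodesic_dist u y)" if u: "norm u = 1" for u
  proof -
    have "u \<bullet> u = 1" "y \<bullet> y = 1"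
      using u y by (simp_all add: norm_eq_1)
    then have "(u - (u \<bullet> y) *\<^sub>R y) \<bullet> (u - (u \<bullet> y) *\<^sub>R y) = 1 - (u \<bullet> y)\<^sup>2"
      by (simp add: inner_diff inner_commute power2_eq_square algebra_simps)
    then have "(norm (u - (u \<bullet> y) *\<^sub>R y))\<^sup>2 = 1 - (u \<bullet> y)\<^sup>2"
      by (simp only: power2_norm_eq_inner)
    also have "\<dots> = (sin (geodesic_dist u y))\<^sup>2"
      by (simp add: sin_squared_eq geodesic_dist_bounds[OF u y])
    finally show ?thesis
      using geodesic_dist_bounds[OF u y] by (simp add: power2_eq_iff_nonneg sin_ge_zero)
  qed
  have "y \<bullet> y = 1"
    using y by (simp add: norm_eq_1)
  then have "x \<bullet> z - (x \<bullet> y) * (z \<bullet> y) = (x - (x \<bullet> y) *\<^sub>R y) \<bullet> (z - (z \<bullet> y) *\<^sub>R y)"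
    by (simp add: inner_diff inner_commute algebra_simps)
  also have "\<dots> \<ge> - (sin (geodesic_dist x y) * sin (geodesic_dist z y))"
    using Cauchy_Schwarz_ineq2[of "x - (x \<bullet> y) *\<^sub>R y" "z - (z \<bullet> y) *\<^sub>R y"] sq[OF x] sq[OF z] by simp
  finally have "cos (geodesic_dist x y + geodesic_dist z y) \<le> x \<bullet> z"
    by (simp add: cos_add geodesic_dist_bounds x y z)
  then show ?thesis
    using True geodesic_dist_bounds[OF x y] geodesic_dist_bounds[OF y z] geodesic_dist_commute[of z y]
    by (subst geodesic_dist_le_iff[OF x z]) auto
next
  case False
  then show ?thesis
    using geodesic_dist_bounds(2)[OF x z] by linarith
qed

text \<open>Rotate \<open>y\<close> by the angle \<open>r\<close> toward an orthogonal unit vector,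
  which exists in dimension at least 2.\<close>

lemma geodesic_dist_surj:
  fixes y :: "real^'n"
  assumes "2 \<le> CARD('n)" and y: "norm y = 1" and r: "0 \<le> r" "r \<le> pi"
  obtains z where "norm z = 1" "geodesic_dist y z = r"
proof -
  obtain v where v: "v \<noteq> 0" "orthogonal y v"
    using orthogonal_to_vector_exists[of y] assms(1) by auto
  define u where "u = v /\<^sub>R norm v"
  have "norm u = 1"
    using v by (simp add: u_def)
  then have u: "u \<bullet> u = 1"
    by (simp only: norm_eq_1)
  have yu: "y \<bullet> u = 0"
    using v by (simp add: u_def orthogonal_def)
  have yy: "y \<bullet> y = 1"
    using y by (simp add: norm_eq_1)
  let ?z = "cos r *\<^sub>R y + sin r *\<^sub>R u"
  have "?z \<bullet> ?z = (cos r)\<^sup>2 + (sin r)\<^sup>2"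
    using u yu yy by (simp add: inner_add inner_commute power2_eq_square)
  then have "norm ?z = 1"
    by (simp add: norm_eq_1)
  moreover have "y \<bullet> ?z = cos r"
    using u yu yy by (simp add: inner_add)
  then have "geodesic_dist y ?z = r"
    using r by (simp add: geodesic_dist_def arccos_cos)
  ultimately show ?thesis
    using that by blast
qed

section \<open>Nets and common neighbors\<close>

lemma geodesic_netE:
  assumes "geodesic_net \<delta> X" "norm y = 1"
  obtains x where "x \<in> X" "norm x = 1" "geodesic_dist y x \<le> \<delta>"
  using assms unfolding geodesic_net_def by (metis mem_sphere_0 subsetD)

text \<open>A net with \<delta> <= 0 contains the whole sphere, which is connected with more than
  one point and so infinite. This is the source of \<epsilon> > 0.\<close>

lemma geodesic_net_pos:
  fixes X :: "(real^'n) set"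
  assumes "2 \<le> CARD('n)" and "finite X" and net: "geodesic_net \<delta> X"
  shows "0 < \<delta>"
proof (rule ccontr)
  assume "\<not> 0 < \<delta>"
  have "sphere 0 1 \<subseteq> X"
  proof
    fix y :: "real^'n" assume y: "y \<in> sphere 0 1"
    then obtain x where x: "x \<in> X" "norm x = 1" "geodesic_dist y x \<le> \<delta>"
      using geodesic_netE[OF net, of y] by auto
    then have "y \<bullet> x \<ge> 1"
      using \<open>\<not> 0 < \<delta>\<close> y geodesic_dist_le_iff[of y x 0] by auto
    then have "(y - x) \<bullet> (y - x) \<le> 0"
      using y x(2) by (simp add: inner_diff inner_commute norm_eq_1)
    then show "y \<in> X"
      using x(1) by (metis inner_gt_zero_iff not_less eq_iff_diff_eq_0)
  qed
  then have "finite (sphere 0 1 :: (real^'n) set)"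
    using assms(2) finite_subset by blast
  moreover have "connected (sphere 0 1 :: (real^'n) set)"
    using assms(1) by (intro connected_sphere) simp
  ultimately obtain a where "sphere 0 1 \<subseteq> {a :: real^'n}"
    using connected_finite_iff_sing[of "sphere 0 1 :: (real^'n) set"] by blast
  moreover obtain e :: "real^'n" where "norm e = 1"
    using vector_choose_size[of 1] by auto
  moreover from this have "norm (- e) = 1"
    by simp
  ultimately have "e = a" "- e = a"
    by (auto simp only: mem_sphere_0 subset_iff singleton_iff)
  then have "e \<bullet> (- e) = e \<bullet> e"
    by metis
  then show False
    using \<open>norm e = 1\<close> by auto
qed

text \<open>For \<alpha> > 0, \<open>w\<close> is a net point near some \<open>z\<close> at distance
  \<alpha> from \<open>y\<close>; triangle inequalities put its distance from every \<open>x\<close>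
  within \<epsilon>/2 of \<alpha>, and \<epsilon> < \<alpha> keeps this distance positive. For
  \<alpha> = 0, \<open>w\<close> lies in an annulus just outside the cap around
  \<open>y\<close>.\<close>

lemma exists_common_neighbor:
  fixes X :: "(real^'n) set"
  assumes card: "2 \<le> CARD('n)" and X: "finite X" and net: "geodesic_net (\<epsilon> / 4) X"
    and \<alpha>: "0 \<le> \<alpha>" "\<alpha> \<le> pi" "\<alpha> = 0 \<or> \<epsilon> < \<alpha>" and "\<epsilon> < pi / 2" and y: "norm y = 1"
  obtains w where "w \<in> X"
    "\<And>x. norm x = 1 \<Longrightarrow> geodesic_dist x y \<le> \<epsilon> / 4 \<Longrightarrow>
       x \<noteq> w \<and> \<alpha> - \<epsilon> \<le> geodesic_dist x w \<and> geodesic_dist x w \<le> \<alpha> + \<epsilon>"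
proof (cases "\<alpha> = 0")
  case False
  have "0 < \<epsilon>"
    using geodesic_net_pos[OF card X net] by simp
  obtain z where z: "norm z = 1" "geodesic_dist y z = \<alpha>"
    using geodesic_dist_surj[OF card y] \<alpha> by blast
  obtain w where w: "w \<in> X" "norm w = 1" "geodesic_dist z w \<le> \<epsilon> / 4"
    using geodesic_netE[OF net z(1)] by blast
  show thesis
  proof (rule that[OF w(1)])
    fix x :: "real^'n" assume x: "norm x = 1" "geodesic_dist x y \<le> \<epsilon> / 4"
    have "geodesic_dist x w \<le> geodesic_dist x y + \<alpha> + geodesic_dist z w"
      using geodesic_dist_triangle[OF x(1) y w(2)] geodesic_dist_triangle[OF y z(1) w(2)] z(2) by linarith
    moreover have "\<alpha> \<le> geodesic_dist x y + geodesic_dist x w + geodesic_dist z w"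
      using geodesic_dist_triangle[OF y x(1) z(1)] geodesic_dist_triangle[OF x(1) w(2) z(1)] z(2)
      by (simp add: geodesic_dist_commute)
    ultimately show "x \<noteq> w \<and> \<alpha> - \<epsilon> \<le> geodesic_dist x w \<and> geodesic_dist x w \<le> \<alpha> + \<epsilon>"
      using w(3) x geodesic_dist_self[of x] False \<alpha>(3) \<open>0 < \<epsilon>\<close> by auto
  qed
next
  case True
  have "0 < \<epsilon>"
    using geodesic_net_pos[OF card X net] by simp
  \<comment> \<open>A net point near a point at distance \<open>\<epsilon> / 2\<close> from \<open>y\<close> might be at distance exactly \<open>\<epsilon> / 4\<close> from \<open>y\<close>
    and so coincide with some \<open>x\<close>. Hence distance \<open>\<epsilon> / 2 + \<eta>\<close> is used, where \<open>\<eta>\<close> is so small that,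
    by finiteness of \<open>X\<close>, the upper bound \<open>3 * \<epsilon> / 4\<close> is not affected.\<close>
  have "\<exists>w\<in>X. \<epsilon> / 4 < geodesic_dist y w \<and> geodesic_dist y w \<le> 3 * \<epsilon> / 4"
  proof (rule ccontr)
    assume contra: "\<not> ?thesis"
    \<comment> \<open>The added element keeps the set nonempty and bounds \<open>m\<close>, so that
      \<eta> <= 1/2 and the radius \<epsilon>/2 + \<eta> stays below pi.\<close>
    let ?D = "insert (3 * \<epsilon> / 4 + 1) {s \<in> geodesic_dist y ` X. 3 * \<epsilon> / 4 < s}"
    define m where "m = Min ?D"
    have fin: "finite ?D"
      using X by simp
    have m: "3 * \<epsilon> / 4 < m" "m \<le> 3 * \<epsilon> / 4 + 1"
      unfolding m_def using Min_gr_iff[OF fin] Min_le[OF fin] by auto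
    have m_le: "m \<le> geodesic_dist y w" if "w \<in> X" "3 * \<epsilon> / 4 < geodesic_dist y w" for w
      unfolding m_def using fin that by (intro Min_le) auto
    define \<eta> where "\<eta> = (m - 3 * \<epsilon> / 4) / 2"
    have \<eta>: "0 < \<eta>" "\<eta> \<le> 1 / 2" "3 * \<epsilon> / 4 + \<eta> < m"
      using m by (auto simp: \<eta>_def field_simps)
    obtain z where z: "norm z = 1" "geodesic_dist y z = \<epsilon> / 2 + \<eta>"
      using geodesic_dist_surj[OF card y, of "\<epsilon> / 2 + \<eta>"] \<eta> \<open>0 < \<epsilon>\<close> \<open>\<epsilon> < pi / 2\<close> pi_gt3 by auto
    obtain w where w: "w \<in> X" "norm w = 1" "geodesic_dist z w \<le> \<epsilon> / 4"
      using geodesic_netE[OF net z(1)] by blast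
    have "geodesic_dist y w \<le> 3 * \<epsilon> / 4 + \<eta>" "\<epsilon> / 4 + \<eta> \<le> geodesic_dist y w"
      using geodesic_dist_triangle[OF y z(1) w(2)] geodesic_dist_triangle[OF y w(2) z(1)] z(2) w(3)
      by (simp_all add: geodesic_dist_commute)
    \<comment> \<open>The distance from \<open>y\<close> to \<open>w\<close> is below
      \<open>m\<close>, hence at most 3\<epsilon>/4 by minimality of \<open>m\<close>; so
      \<open>w\<close> is the point assumed absent.\<close>
    then show False
      using contra w(1) m_le[of w] \<eta> by force
  qed
  then obtain w where w: "w \<in> X" "\<epsilon> / 4 < geodesic_dist y w" "geodesic_dist y w \<le> 3 * \<epsilon> / 4"
    by blast
  then have w1: "norm w = 1"
    using net by (auto simp: geodesic_net_def)
  show thesis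
  proof (rule that[OF w(1)])
    fix x :: "real^'n" assume x: "norm x = 1" "geodesic_dist x y \<le> \<epsilon> / 4"
    have "x \<noteq> w"
      using x(2) w(2) geodesic_dist_commute[of x y] by auto
    then show "x \<noteq> w \<and> \<alpha> - \<epsilon> \<le> geodesic_dist x w \<and> geodesic_dist x w \<le> \<alpha> + \<epsilon>"
      using True \<open>0 < \<epsilon>\<close> geodesic_dist_triangle[OF x(1) y w1] geodesic_dist_bounds(1)[OF x(1) w1] x(2) w(3)
      by auto
  qed
qed

text \<open>With threshold cos(\<epsilon>/4) the caps are geodesic balls of radius \<epsilon>/4: the
  net makes them meet \<open>X\<close>, common neighbors make their traces simplices, and \<epsilon>
  < |\<alpha> - pi/2| puts each simplex in an open hemisphere.\<close>

lemma has_essential_sphere_distance_graph: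
  fixes X :: "(real^'n) set"
  assumes card: "CARD('n) = d + 1" and d: "d \<ge> 1"
    and X: "finite X" and net: "geodesic_net (\<epsilon> / 4) X"
    and \<alpha>: "0 \<le> \<alpha>" "\<alpha> \<le> pi" "\<alpha> = 0 \<or> \<epsilon> < \<alpha>" and \<epsilon>: "\<epsilon> < \<bar>\<alpha> - pi / 2\<bar>"
  shows "has_essential_sphere d (geometric_realization (neighborhood_complex (distance_graph \<alpha> X \<epsilon>)))"
proof (rule has_essential_sphere_geometric_realization[of d X "cos (\<epsilon> / 4)"])
  let ?K = "neighborhood_complex (distance_graph \<alpha> X \<epsilon>)"
  have card2: "2 \<le> CARD('n)"
    using card d by simp
  have \<epsilon>_pos: "0 < \<epsilon>"
    using geodesic_net_pos[OF card2 X net] by simp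
  have \<epsilon>_less: "\<epsilon> < pi / 2"
    using \<epsilon> \<alpha> by (auto simp: abs_if split: if_splits)
  have X_unit: "norm x = 1" if "x \<in> X" for x
    using net that by (auto simp: geodesic_net_def)
  have cap_iff: "cos (\<epsilon> / 4) \<le> x \<bullet> y \<longleftrightarrow> geodesic_dist x y \<le> \<epsilon> / 4" if "norm x = 1" "norm y = 1" for x y :: "real^'n"
    using geodesic_dist_le_iff[OF that, of "\<epsilon> / 4"] \<epsilon>_pos \<epsilon>_less by simp
  show "DIM(real^'n) = d + 1"
    by (simp add: card)
  show "0 < cos (\<epsilon> / 4)"
    using \<epsilon>_pos \<epsilon>_less by (intro cos_gt_zero) auto
  show "\<exists>x\<in>X. cos (\<epsilon> / 4) \<le> x \<bullet> y" if "y \<in> sphere 0 1" for y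
  proof -
    have y: "norm y = 1"
      using that by simp
    obtain x where "x \<in> X" "norm x = 1" "geodesic_dist y x \<le> \<epsilon> / 4"
      using geodesic_netE[OF net y] .
    then show ?thesis
      using cap_iff[of x y] y geodesic_dist_commute[of y x] by auto
  qed
  show "{x \<in> X. cos (\<epsilon> / 4) \<le> x \<bullet> y} \<in> ?K" if "y \<in> sphere 0 1" for y
  proof -
    have y: "norm y = 1"
      using that by simp
    obtain w where "w \<in> X" and w: "\<And>x. norm x = 1 \<Longrightarrow> geodesic_dist x y \<le> \<epsilon> / 4 \<Longrightarrow>
       x \<noteq> w \<and> \<alpha> - \<epsilon> \<le> geodesic_dist x w \<and> geodesic_dist x w \<le> \<alpha> + \<epsilon>"
      using exists_common_neighbor[OF card2 X net \<alpha> \<epsilon>_less y] by blast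
    moreover have "x \<noteq> w \<and> \<alpha> - \<epsilon> \<le> geodesic_dist x w \<and> geodesic_dist x w \<le> \<alpha> + \<epsilon>"
      if "x \<in> X" "cos (\<epsilon> / 4) \<le> x \<bullet> y" for x
      using w X_unit cap_iff y that by blast
    ultimately have "w \<in> X \<inter> (\<Inter>x\<in>{x \<in> X. cos (\<epsilon> / 4) \<le> x \<bullet> y}. neighbors (distance_graph \<alpha> X \<epsilon>) x)"
      by (simp add: neighbors_def distance_graph_def)
    then show ?thesis
      unfolding neighborhood_complex_def by (auto simp: distance_graph_def)
  qed
  show "B \<in> ?K" if "A \<in> ?K" "B \<subseteq> A" for A B
    using that unfolding neighborhood_complex_def by blast
  show "A \<subseteq> X \<and> (\<exists>w. \<forall>v\<in>A. 0 < v \<bullet> w)" if A_K: "A \<in> ?K" for A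
  proof
    show A: "A \<subseteq> X"
      using A_K by (simp add: neighborhood_complex_def distance_graph_def)
    obtain w where w: "w \<in> X" and "w \<in> (\<Inter>v\<in>A. neighbors (distance_graph \<alpha> X \<epsilon>) v)"
      using A_K by (auto simp: neighborhood_complex_def distance_graph_def)
    then have adj: "\<alpha> - \<epsilon> \<le> geodesic_dist v w \<and> geodesic_dist v w \<le> \<alpha> + \<epsilon>" if "v \<in> A" for v
      using that by (auto simp: neighbors_def distance_graph_def)
    have dist: "0 \<le> geodesic_dist v w" "geodesic_dist v w \<le> pi" "cos (geodesic_dist v w) = v \<bullet> w"
      if "v \<in> A" for v
      using geodesic_dist_bounds[of v w] X_unit that A w by auto
    show "\<exists>w. \<forall>v\<in>A. 0 < v \<bullet> w"
    proof (cases "\<alpha> < pi / 2")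
      case True
      have "0 < v \<bullet> w" if v: "v \<in> A" for v
        using cos_gt_zero_pi[of "geodesic_dist v w"] dist[OF v] adj[OF v] True \<epsilon> by auto
      then show ?thesis
        by blast
    next
      case False
      \<comment> \<open>The annulus around \<open>w\<close> now lies beyond the equator, so the
        hemisphere is centered at \<open>- w\<close>.\<close>
      have "0 < v \<bullet> (- w)" if v: "v \<in> A" for v
      proof -
        have "pi / 2 < geodesic_dist v w"
          using False adj[OF v] \<epsilon> by (auto simp: abs_if split: if_splits)
        then have "cos (geodesic_dist v w) < cos (pi / 2)"
          using dist(2)[OF v] by (intro cos_monotone_0_pi) auto
        then show ?thesis
          using dist(3)[OF v] by simp
      qed
      then show ?thesis
        by blast
    qed
  qed
qed (use X d in auto)

section \<open>Measurability\<close>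

text \<open>The set is a union of classes of points with equal truth values of \<open>P\<close>;
  there are finitely many such patterns, and each class is a finite Boolean combination of
  measurable sets.\<close>

lemma sets_Collect_finite_pattern:
  assumes J: "finite J" and P: "\<And>k. k \<in> J \<Longrightarrow> {x \<in> space M. P k x} \<in> sets M"
    and Q: "\<And>x y. x \<in> space M \<Longrightarrow> y \<in> space M \<Longrightarrow> (\<And>k. k \<in> J \<Longrightarrow> P k x \<longleftrightarrow> P k y) \<Longrightarrow> Q x \<Longrightarrow> Q y"
  shows "{x \<in> space M. Q x} \<in> sets M"
proof -
  let ?pat = "\<lambda>y. {k \<in> J. P k y}"
  have "{x \<in> space M. \<forall>k\<in>J. P k x \<longleftrightarrow> k \<in> S} \<in> sets M" for S
  proof (rule sets.sets_Collect_finite_All[OF _ J])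
    show "{x \<in> space M. P k x \<longleftrightarrow> k \<in> S} \<in> sets M" if "k \<in> J" for k
      using P[OF that] sets.sets_Collect_neg[OF P[OF that]] by (cases "k \<in> S") auto
  qed
  moreover have "finite (?pat ` {y \<in> space M. Q y})"
    by (rule finite_subset[of _ "Pow J"]) (use J in auto)
  ultimately have "(\<Union>S\<in>?pat ` {y \<in> space M. Q y}. {x \<in> space M. \<forall>k\<in>J. P k x \<longleftrightarrow> k \<in> S}) \<in> sets M"
    by (rule sets.finite_UN[rotated])
  also have "(\<Union>S\<in>?pat ` {y \<in> space M. Q y}. {x \<in> space M. \<forall>k\<in>J. P k x \<longleftrightarrow> k \<in> S}) =
      {x \<in> space M. Q x}" (is "?U = ?V")
  proof
    show "?U \<subseteq> ?V"
    proof
      fix x assume "x \<in> ?U"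
      then obtain y where "y \<in> space M" "Q y" "x \<in> space M" "\<And>k. k \<in> J \<Longrightarrow> P k x \<longleftrightarrow> P k y"
        by auto
      then show "x \<in> ?V"
        using Q[of y x] by simp
    qed
    show "?V \<subseteq> ?U"
      by auto
  qed
  finally show ?thesis .
qed

lemma measurable_uniform_points_component:
  assumes "i < n"
  shows "(\<lambda>x. x i) \<in> borel_measurable (uniform_points n :: (nat \<Rightarrow> real^'n) measure)"
proof -
  have "(\<lambda>x. x i) \<in> uniform_points n \<rightarrow>\<^sub>M (uniform_sphere :: (real^'n) measure)"
    unfolding uniform_points_def using assms by (intro measurable_component_singleton) simp
  moreover have "(\<lambda>x. x) \<in> borel_measurable (uniform_sphere :: (real^'n) measure)"
    unfolding measurable_cong_sets[OF sets_uniform_sphere refl] by (intro measurable_restrict_space1) simp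
  ultimately show ?thesis
    using measurable_compose by blast
qed

lemma norm_uniform_points: "x \<in> space (uniform_points n) \<Longrightarrow> i < n \<Longrightarrow> norm (x i) = 1"
  by (auto simp: uniform_points_def space_PiM space_uniform_sphere dest!: PiE_mem)

lemma sets_geodesic_dist_between:
  assumes "i < n" "j < n"
  shows "{x \<in> space (uniform_points n). a \<le> geodesic_dist (x i) (x j) \<and> geodesic_dist (x i) (x j) \<le> b}
           \<in> sets (uniform_points n :: (nat \<Rightarrow> real^'n) measure)"
proof -
  let ?M = "uniform_points n :: (nat \<Rightarrow> real^'n) measure"
  \<comment> \<open>Outside [-1, 1] \<open>arccos\<close> is unspecified, so the preimage is taken
    within this interval, where inner products of unit vectors lie.\<close>
  have cl: "closed ({-1..1} \<inter> arccos -` {a..b})"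
    by (rule continuous_closed_preimage[OF continuous_on_arccos']) auto
  have "(\<lambda>x. x i \<bullet> x j) \<in> borel_measurable ?M"
    by (intro borel_measurable_inner measurable_uniform_points_component assms)
  from measurable_sets[OF this borel_closed[OF cl]]
  have "(\<lambda>x. x i \<bullet> x j) -` ({-1..1} \<inter> arccos -` {a..b}) \<inter> space ?M \<in> sets ?M" .
  moreover have "- 1 \<le> x i \<bullet> x j" "x i \<bullet> x j \<le> 1" if "x \<in> space ?M" for x
    using inner_unit_bounds norm_uniform_points[OF that] assms by blast+
  then have "(\<lambda>x. x i \<bullet> x j) -` ({-1..1} \<inter> arccos -` {a..b}) \<inter> space ?M =
      {x \<in> space ?M. a \<le> geodesic_dist (x i) (x j) \<and> geodesic_dist (x i) (x j) \<le> b}"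
    unfolding geodesic_dist_def by auto
  ultimately show ?thesis
    by simp
qed

text \<open>The pattern of coincidences and adjacencies determines the graph up to isomorphism,
  hence the realization up to homeomorphism.\<close>

lemma sets_has_essential_sphere:
  "{x \<in> space (uniform_points n). has_essential_sphere d
       (geometric_realization (neighborhood_complex (distance_graph \<alpha> (x ` {..<n}) \<epsilon>)))}
     \<in> sets (uniform_points n :: (nat \<Rightarrow> real^'n) measure)"
proof -
  let ?M = "uniform_points n :: (nat \<Rightarrow> real^'n) measure"
  let ?I = "{..<n}"
  define adj where "adj x i j \<longleftrightarrow> \<alpha> - \<epsilon> \<le> geodesic_dist (x i) (x j) \<and> geodesic_dist (x i) (x j) \<le> \<alpha> + \<epsilon>"
    for x :: "nat \<Rightarrow> real^'n" and i j
  \<comment> \<open>The Boolean selects the question: coincidence of two points for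
    \<open>True\<close>, distance in the given range for \<open>False\<close>. As \<open>adj\<close>
    does not exclude equal points, both are needed to recover the edges.\<close>
  let ?J = "?I \<times> ?I \<times> (UNIV :: bool set)"
  define P where "P = (\<lambda>(i, j, b) x. if b then x i = x j else adj x i j)"
  let ?G = "\<lambda>x. geometric_realization (neighborhood_complex (distance_graph \<alpha> (x ` ?I) \<epsilon>))"
  have meas: "{x \<in> space ?M. P k x} \<in> sets ?M" if "k \<in> ?J" for k
  proof -
    obtain i j b where ijb: "k = (i, j, b)"
      by (cases k)
    then have k: "i < n" "j < n"
      using that by auto
    show ?thesis
    proof (cases b)
      case True
      have "{x \<in> space ?M. x i = x j} \<in> sets ?M"
        by (intro measurable_equality_set measurable_uniform_points_component k)
      then show ?thesis
        by (simp only: ijb True P_def prod.case if_True)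
    next
      case False
      then show ?thesis
        using sets_geodesic_dist_between[OF k] by (simp only: ijb P_def adj_def prod.case if_False)
    qed
  qed
  have invariant: "has_essential_sphere d (?G y)"
    if pattern: "\<And>k. k \<in> ?J \<Longrightarrow> P k x \<longleftrightarrow> P k y" and x: "has_essential_sphere d (?G x)" for x y
  proof -
    have eq: "x i = x j \<longleftrightarrow> y i = y j" and adj: "adj x i j \<longleftrightarrow> adj y i j" if "i < n" "j < n" for i j
      using pattern[of "(i, j, True)"] pattern[of "(i, j, False)"] that by (simp_all add: P_def)
    \<comment> \<open>Sends \<open>y i\<close> to \<open>x i\<close>; the chosen preimage index does
      not matter because both tuples have the same coincidences.\<close>
    define \<psi> where "\<psi> u = x (inv_into ?I y u)" for u
    have \<psi>: "\<psi> (y i) = x i" if "i < n" for i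
    proof -
      have "inv_into ?I y (y i) \<in> ?I" "y (inv_into ?I y (y i)) = y i"
        using that by (intro inv_into_into f_inv_into_f; simp)+
      then show ?thesis
        using eq that by (simp add: \<psi>_def)
    qed
    have bij: "bij_betw \<psi> (y ` ?I) (x ` ?I)"
      unfolding bij_betw_def inj_on_def using \<psi> eq by (force simp: image_image)
    have edge: "(u, v) \<in> snd (distance_graph \<alpha> (y ` ?I) \<epsilon>) \<longleftrightarrow>
        (\<psi> u, \<psi> v) \<in> snd (distance_graph \<alpha> (x ` ?I) \<epsilon>)" if uv: "u \<in> y ` ?I" "v \<in> y ` ?I" for u v
    proof -
      obtain i j where ij: "i < n" "j < n" "u = y i" "v = y j"
        using uv by auto
      have "(z i, z j) \<in> snd (distance_graph \<alpha> (z ` ?I) \<epsilon>) \<longleftrightarrow> z i \<noteq> z j \<and> adj z i j" for z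
        using ij(1,2) by (simp add: distance_graph_def adj_def)
      then show ?thesis
        using eq[OF ij(1,2)] adj[OF ij(1,2)] \<psi>[OF ij(1)] \<psi>[OF ij(2)] ij(3,4) by metis
    qed
    have "?G x homeomorphic_space ?G y"
      using geometric_realization_neighborhood_complex_homeomorphic[OF bij edge]
      by (simp add: distance_graph_def)
    then show ?thesis
      using x by (rule has_essential_sphere_homeomorphic)
  qed
  show ?thesis
  proof (rule sets_Collect_finite_pattern[where J = ?J and P = P])
    show "finite ?J"
      by simp
    show "{x \<in> space ?M. P k x} \<in> sets ?M" if "k \<in> ?J" for k
      using that by (rule meas)
    show "has_essential_sphere d (?G y)"
      if "\<And>k. k \<in> ?J \<Longrightarrow> P k x \<longleftrightarrow> P k y" "has_essential_sphere d (?G x)" for x y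
      using that by (rule invariant)
  qed
qed

section \<open>Passage to probabilities and conclusion\<close>

lemma prob_space_uniform_points: "prob_space (uniform_points n :: (nat \<Rightarrow> real^'n) measure)"
  unfolding uniform_points_def by (intro prob_space_PiM prob_space_uniform_sphere)

text \<open>Measurability of the larger event gives monotonicity of the measure, and its probability
  is squeezed between that of the smaller event and 1.\<close>

lemma asymptotically_almost_surely_mono:
  assumes P: "asymptotically_almost_surely (P :: nat \<Rightarrow> (real^'n) set \<Rightarrow> bool)"
    and imp: "\<forall>\<^sub>F n in sequentially. \<forall>X. finite X \<longrightarrow> P n X \<longrightarrow> Q n X"
    and sets: "\<And>n. {x \<in> space (uniform_points n). Q n (x ` {..<n})}
                \<in> sets (uniform_points n :: (nat \<Rightarrow> real^'n) measure)"
  shows "asymptotically_almost_surely Q"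
  unfolding asymptotically_almost_surely_def
proof (rule tendsto_sandwich)
  let ?M = "uniform_points :: nat \<Rightarrow> (nat \<Rightarrow> real^'n) measure"
  show "(\<lambda>n. measure (?M n) {x \<in> space (?M n). P n (x ` {..<n})}) \<longlonglongrightarrow> 1"
    using P by (simp add: asymptotically_almost_surely_def)
  show "\<forall>\<^sub>F n in sequentially. measure (?M n) {x \<in> space (?M n). P n (x ` {..<n})}
          \<le> measure (?M n) {x \<in> space (?M n). Q n (x ` {..<n})}"
    using imp
  proof eventually_elim
    case (elim n)
    interpret prob_space "?M n"
      by (rule prob_space_uniform_points)
    show ?case
      using elim by (intro finite_measure_mono sets) auto
  qed
  show "\<forall>\<^sub>F n in sequentially. measure (?M n) {x \<in> space (?M n). Q n (x ` {..<n})} \<le> 1"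
    by (intro always_eventually allI prob_space.prob_le_1 prob_space_uniform_points)
qed simp

theorem theorem3p1:
  fixes d :: nat and \<alpha> C :: real and \<epsilon> :: "nat \<Rightarrow> real"
  assumes "CARD('n::finite) = d + 1" and "d \<ge> 1"
    and "0 \<le> \<alpha>" and "\<alpha> \<le> pi" and "\<alpha> \<noteq> pi / 2"
    and "\<And>\<eta>. admissible_rate d C \<eta> \<Longrightarrow>
           asymptotically_almost_surely (\<lambda>n (X :: (real^'n) set). geodesic_net (\<eta> n / 4) X)"
    and "admissible_rate d C \<epsilon>"
  shows "asymptotically_almost_surely (\<lambda>n (X :: (real^'n) set).
           let N = geometric_realization (neighborhood_complex (distance_graph \<alpha> X (\<epsilon> n))) in
           (\<exists>h \<in> hom integer_group (homology_group (int d) N).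
              inj_on h (carrier integer_group)) \<and>
           conn N \<le> ereal (real d - 1))"
proof -
  have "asymptotically_almost_surely (\<lambda>n (X :: (real^'n) set). has_essential_sphere d
      (geometric_realization (neighborhood_complex (distance_graph \<alpha> X (\<epsilon> n)))))"
  proof (rule asymptotically_almost_surely_mono[OF assms(6)[OF assms(7)]])
    \<comment> \<open>As \<epsilon> tends to 0, it is eventually below the positive number |\<alpha>
      - pi/2| and, unless \<alpha> = 0, below \<alpha>.\<close>
    have lim: "\<epsilon> \<longlonglongrightarrow> 0"
      using assms(7) by (simp add: admissible_rate_def)
    have "\<forall>\<^sub>F n in sequentially. \<epsilon> n < \<bar>\<alpha> - pi / 2\<bar>"
      using assms(5) by (intro order_tendstoD(2)[OF lim]) auto
    moreover have "\<forall>\<^sub>F n in sequentially. \<alpha> = 0 \<or> \<epsilon> n < \<alpha>"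
      using order_tendstoD(2)[OF lim, of \<alpha>] assms(3) by (cases "\<alpha> = 0") auto
    ultimately show "\<forall>\<^sub>F n in sequentially. \<forall>X :: (real^'n) set. finite X \<longrightarrow> geodesic_net (\<epsilon> n / 4) X \<longrightarrow>
        has_essential_sphere d (geometric_realization (neighborhood_complex (distance_graph \<alpha> X (\<epsilon> n))))"
    proof eventually_elim
      case (elim n)
      show ?case
        using has_essential_sphere_distance_graph[OF assms(1,2) _ _ assms(3,4) elim(2,1)] by blast
    qed
    show "{x \<in> space (uniform_points n). has_essential_sphere d (geometric_realization
              (neighborhood_complex (distance_graph \<alpha> (x ` {..<n}) (\<epsilon> n))))}
            \<in> sets (uniform_points n :: (nat \<Rightarrow> real^'n) measure)" for n
      by (rule sets_has_essential_sphere)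
  qed
  then show ?thesis
    unfolding Let_def has_essential_sphere_def .
qed

end
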